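(* Let $k\geq 2$ and $n$ be positive integers, and let $a_1<a_2<\cdots<a_k$ be positive integers satisfying $$\frac{n}{2^{n}}=\sum_{i=1}^{k}\frac{a_{i}}{2^{a_{i}}}.$$ Then: (i) $n\leq 2^{k+1}-k-2$; (ii) $n+1\leq a_1\leq n+3$ and $2^{a_k-a_{k-1}}$ divides $a_k$. Moreover, if $n\geq 2^{j+1}-j$ for some integer $j$ with $1\leq j<k$, then $a_i=n+i$ for all $i=1,\ldots,j$.
   Context: The equation $\frac{n}{2^{n}}=\sum_{i=1}^{k}\frac{a_{i}}{2^{a_{i}}}$ (the Erdős–Graham equation) is considered in positive integers $n,k,a_1,\ldots,a_k$ with $k\geq 2$ and $a_1<a_2<\cdots<a_k$. *)

theory Defs
  imports Complex_Main
begin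

end

theory Submission
  imports Defs
begin

text \<open>
  Write \<open>f m = m / 2\<^sup>m\<close>. On positive integers \<open>f\<close> is antitone, and \<open>f (m + 1) = g m - g (m + 1)\<close> for
  \<open>g m = (m + 2) / 2\<^sup>m\<close>, so sums of \<open>f\<close> over consecutive integers telescope. Antitonicity
  forces \<open>n < a\<^sub>1\<close>; comparing the right-hand side with sums over consecutive integers beyond
  \<open>n\<close> gives \<open>f n \<le> g n - g (n + k)\<close>, which is the bound on \<open>n\<close>. If \<open>a\<^sub>i = n + i\<close> for \<open>i \<le> p\<close> but not
  for \<open>i = p + 1\<close>, then the integer \<open>n + p + 1\<close> is skipped and \<open>f n < g n - f (n + p + 1)\<close>, that is
  \<open>n + p + 1 < 2\<^bsup>p + 2\<^esup>\<close>. The divisibility is read off after clearing denominators.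
\<close>

definition dyadic_term :: "nat \<Rightarrow> real" where
  "dyadic_term m = real m / 2 ^ m"

text \<open>Closed form of the infinite sum of \<open>dyadic_term l\<close> over all
  \<open>l > m\<close>.\<close>

definition dyadic_tail :: "nat \<Rightarrow> real" where
  "dyadic_tail m = (real m + 2) / 2 ^ m"

lemma dyadic_tail_pos: "0 < dyadic_tail m"
  by (simp add: dyadic_tail_def add_nonneg_pos)

lemma dyadic_term_Suc: "dyadic_term (Suc m) = dyadic_tail m - dyadic_tail (Suc m)"
  by (simp add: dyadic_term_def dyadic_tail_def field_simps)

text \<open>The ratio of successive terms is \<open>(m + 1) / (2 * m)\<close>, at most 1 once
  \<open>m >= 1\<close>. It equals 1 at \<open>m = 1\<close>, so the decrease is not strict, and the
  term at 0 vanishes, so 0 is excluded.\<close>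

lemma dyadic_term_antimono:
  assumes "1 \<le> m" "m \<le> m'"
  shows "dyadic_term m' \<le> dyadic_term m"
  using assms(2)
proof (induction m' rule: dec_induct)
  case base
  show ?case by simp
next
  case (step i)
  have "dyadic_term (Suc i) \<le> dyadic_term i"
    using assms(1) step.hyps by (simp add: dyadic_term_def field_simps)
  with step.IH show ?case by simp
qed

lemma sum_consecutive_dyadic_terms:
  assumes "p \<le> k"
  shows "(\<Sum>l = Suc p..k. dyadic_term (m + l)) = dyadic_tail (m + p) - dyadic_tail (m + k)"
  using assms by (induction k rule: dec_induct) (simp_all add: dyadic_term_Suc)

lemma strict_mono_on_add_le:
  fixes a :: "nat \<Rightarrow> nat"
  assumes mono: "strict_mono_on {1..k} a"
    and start: "m + Suc p \<le> a (Suc p)" and l: "Suc p \<le> l" "l \<le> k"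
  shows "m + l \<le> a l"
  using l
proof (induction l rule: dec_induct)
  case base
  show ?case by (fact start)
next
  case (step i)
  have "a i < a (Suc i)"
    using step.hyps step.prems by (intro strict_mono_onD[OF mono]) auto
  with step.IH step.prems show ?case by simp
qed

text \<open>Strict growth keeps \<open>a l\<close> at or above \<open>m + l\<close>, so the block of
  consecutive integers dominates termwise and telescopes. The free shift \<open>m\<close> allows
  comparison with blocks starting at different distances from \<open>n\<close>.\<close>

lemma sum_dyadic_terms_le:
  fixes a :: "nat \<Rightarrow> nat"
  assumes mono: "strict_mono_on {1..k} a"
    and start: "m + Suc p \<le> a (Suc p)" and p: "p \<le> k"
  shows "(\<Sum>l = Suc p..k. dyadic_term (a l)) \<le> dyadic_tail (m + p) - dyadic_tail (m + k)"
proof -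
  have "(\<Sum>l = Suc p..k. dyadic_term (a l)) \<le> (\<Sum>l = Suc p..k. dyadic_term (m + l))"
    by (intro sum_mono dyadic_term_antimono strict_mono_on_add_le[OF mono start]) auto
  also have "\<dots> = dyadic_tail (m + p) - dyadic_tail (m + k)"
    by (rule sum_consecutive_dyadic_terms[OF p])
  finally show ?thesis .
qed

text \<open>Carries the lower bound on \<open>n\<close> assumed for \<open>j\<close> down to every
  index \<open>i\<close> up to \<open>j\<close>.\<close>

lemma two_power_Suc_diff_mono:
  assumes "i \<le> j"
  shows "(2::int) ^ (i + 1) - int i \<le> 2 ^ (j + 1) - int j"
  using assms
proof (induction j rule: dec_induct)
  case base
  show ?case by simp
next
  case (step j)
  have "(2::int) ^ (j + 1) - int j \<le> 2 ^ (Suc j + 1) - int (Suc j)"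
    using one_le_power[of "2::int" j]
    unfolding Suc_eq_plus1[symmetric] power_Suc of_nat_Suc by linarith
  with step.IH show ?case by linarith
qed

theorem theorem2p1:
  fixes k n :: nat and a :: "nat \<Rightarrow> nat"
  assumes k_ge_2: "k \<ge> 2"
    and n_pos: "n \<ge> 1"
    and a_pos: "\<And>i. i \<in> {1..k} \<Longrightarrow> a i \<ge> 1"
    and a_strict: "strict_mono_on {1..k} a"
    and eq: "real n / 2 ^ n = (\<Sum>i = 1..k. real (a i) / 2 ^ a i)"
  shows "int n \<le> 2 ^ (k + 1) - int k - 2
    \<and> (n + 1 \<le> a 1 \<and> a 1 \<le> n + 3)
    \<and> 2 ^ (a k - a (k - 1)) dvd a k
    \<and> (\<forall>j::nat. 1 \<le> j \<and> j < k \<and> int n \<ge> 2 ^ (j + 1) - int j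
          \<longrightarrow> (\<forall>i\<in>{1..j}. a i = n + i))"
proof -
  have eq': "dyadic_term n = (\<Sum>l = Suc 0..k. dyadic_term (a l))"
    using eq by (simp add: dyadic_term_def)
  have lower: "n + 1 \<le> a 1"
  proof (rule ccontr)
    assume "\<not> n + 1 \<le> a 1"
    then have le: "dyadic_term n \<le> dyadic_term (a 1)"
      using a_pos[of 1] k_ge_2 by (intro dyadic_term_antimono) auto
    \<comment> \<open>The first term alone may only equal \<open>dyadic_term n\<close>; a second
      positive term makes the sum too large.\<close>
    have "0 < dyadic_term (a 2)"
      using a_pos[of 2] k_ge_2 by (simp add: dyadic_term_def)
    with le have "dyadic_term n < (\<Sum>l\<in>{1, 2}. dyadic_term (a l))"
      by simp
    also have "\<dots> \<le> (\<Sum>l = Suc 0..k. dyadic_term (a l))"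
      using k_ge_2 by (intro sum_mono2) (auto simp: dyadic_term_def)
    finally show False using eq' by simp
  qed
  have upper: "a 1 \<le> n + 3"
  proof (rule ccontr)
    assume "\<not> a 1 \<le> n + 3"
    then have "dyadic_term n \<le> dyadic_tail (n + 3) - dyadic_tail (n + 3 + k)"
      unfolding eq' using sum_dyadic_terms_le[OF a_strict, of "n + 3" 0] by simp
    with dyadic_tail_pos[of "n + 3 + k"] have "dyadic_term n < dyadic_tail (n + 3)"
      by linarith
    \<comment> \<open>With denominators cleared the inequality reads \<open>8 * n < n + 5\<close>,
      which fails for \<open>n >= 1\<close>.\<close>
    with n_pos show False
      by (simp add: dyadic_term_def dyadic_tail_def power_add field_simps)
  qed
  have bound: "int n \<le> 2 ^ (k + 1) - int k - 2"
  proof -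
    have "dyadic_term n \<le> dyadic_tail n - dyadic_tail (n + k)"
      unfolding eq' using sum_dyadic_terms_le[OF a_strict, of n 0] lower by simp
    \<comment> \<open>Since \<open>dyadic_tail n - dyadic_term n\<close> is
      \<open>2 / 2 ^ n\<close>, the inequality says that \<open>dyadic_tail (n + k)\<close> is at
      most \<open>2 / 2 ^ n\<close>.\<close>
    then have "(real n + real k + 2) * 2 ^ n \<le> (2 * 2 ^ k) * 2 ^ n"
      by (simp add: dyadic_term_def dyadic_tail_def power_add field_simps)
    then have "real n + real k + 2 \<le> 2 * 2 ^ k"
      by (rule mult_right_le_imp_le) simp
    then have "real_of_int (int n + int k + 2) \<le> real_of_int (2 * 2 ^ k)"
      by simp
    then have "int n + int k + 2 \<le> 2 * 2 ^ k"
      by (simp only: of_int_le_iff)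
    then show ?thesis by simp
  qed
  have dvd: "2 ^ (a k - a (k - 1)) dvd a k"
  proof -
    have le_ak: "a i \<le> a (k - 1)" if "i \<in> {1..<k}" for i
      using strict_mono_on_leD[OF a_strict, of i "k - 1"] that by auto
    have ak: "a (k - 1) < a k"
      using k_ge_2 by (intro strict_mono_onD[OF a_strict]) auto
    have n_le: "n \<le> a (k - 1)"
      using le_ak[of 1] lower k_ge_2 by simp
    have clear: "real m / 2 ^ m * 2 ^ a k = real (m * 2 ^ (a k - m))" if "m \<le> a k" for m
      using that by (simp add: field_simps flip: power_add)
    have "real (n * 2 ^ (a k - n)) = real n / 2 ^ n * 2 ^ a k"
      using n_le ak by (intro clear[symmetric]) simp
    also have "\<dots> = (\<Sum>i = 1..k. real (a i) / 2 ^ a i * 2 ^ a k)"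
      by (simp add: eq sum_distrib_right)
    also have "\<dots> = (\<Sum>i = 1..k. real (a i * 2 ^ (a k - a i)))"
      using strict_mono_on_leD[OF a_strict] by (intro sum.cong refl clear) auto
    finally have "real (n * 2 ^ (a k - n)) = real (\<Sum>i = 1..k. a i * 2 ^ (a k - a i))"
      by (simp only: of_nat_sum)
    then have "n * 2 ^ (a k - n) = (\<Sum>i = 1..k. a i * 2 ^ (a k - a i))"
      by (simp only: of_nat_eq_iff)
    also have "{1..k} = insert k {1..<k}"
      using k_ge_2 by auto
    finally have nat_eq: "n * 2 ^ (a k - n) = a k + (\<Sum>i = 1..<k. a i * 2 ^ (a k - a i))"
      by simp
    \<comment> \<open>Both \<open>n\<close> and every \<open>a i\<close> with \<open>i < k\<close>
      are at most \<open>a (k - 1)\<close>, so each term except \<open>a k\<close> carries a power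
      of 2 with exponent at least \<open>a k - a (k - 1)\<close>.\<close>
    have "2 ^ (a k - a (k - 1)) dvd n * 2 ^ (a k - n)"
      using n_le by (intro dvd_mult le_imp_power_dvd) simp
    moreover have "2 ^ (a k - a (k - 1)) dvd (\<Sum>i = 1..<k. a i * 2 ^ (a k - a i))"
      using le_ak by (intro dvd_sum dvd_mult le_imp_power_dvd diff_le_mono2) auto
    ultimately show ?thesis
      unfolding nat_eq by (simp add: dvd_add_left_iff)
  qed
  have initial: "a i = n + i"
    if j: "j < k" "int n \<ge> 2 ^ (j + 1) - int j" and i: "1 \<le> i" "i \<le> j" for i j
    using i
  proof (induction i rule: less_induct)
    case (less i)
    obtain p where p: "i = Suc p"
      using less.prems by (cases i) auto
    show ?case
    proof (rule ccontr)
      assume ne: "a i \<noteq> n + i"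
      have "n + i \<le> a i"
        using strict_mono_on_add_le[OF a_strict, of n 0 i] lower less.prems j(1) by simp
      \<comment> \<open>Missing the value \<open>n + i\<close> pushes all later terms one further,
        so the comparison block can start from \<open>n + 1\<close> instead of
        \<open>n\<close>.\<close>
      with ne have gap: "n + 1 + Suc p \<le> a (Suc p)"
        by (simp add: p)
      have pk: "p \<le> k"
        using less.prems j(1) p by simp
      have "dyadic_term n = (\<Sum>l = Suc 0..p. dyadic_term (a l)) + (\<Sum>l = Suc p..k. dyadic_term (a l))"
        unfolding eq'
        using sum.ub_add_nat[of "Suc 0" p "\<lambda>l. dyadic_term (a l)" "k - p"] pk by simp
      also have "(\<Sum>l = Suc 0..p. dyadic_term (a l)) = (\<Sum>l = Suc 0..p. dyadic_term (n + l))"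
        using less p by (intro sum.cong) auto
      also have "\<dots> = dyadic_tail n - dyadic_tail (n + p)"
        using sum_consecutive_dyadic_terms[of 0 p n] by simp
      also have "(\<Sum>l = Suc p..k. dyadic_term (a l))
          \<le> dyadic_tail (n + 1 + p) - dyadic_tail (n + 1 + k)"
        by (rule sum_dyadic_terms_le[OF a_strict gap pk])
      also have "\<dots> < dyadic_tail (n + 1 + p)"
        using dyadic_tail_pos[of "n + 1 + k"] by simp
      \<comment> \<open>Passing from \<open>dyadic_tail (n + p)\<close> to
        \<open>dyadic_tail (n + 1 + p)\<close> loses exactly the term of the skipped
        integer.\<close>
      finally have "dyadic_term n < dyadic_tail n - dyadic_term (Suc (n + p))"
        by (simp add: dyadic_term_Suc)
      then have "(real n + real p + 1) * 2 ^ n < (4 * 2 ^ p) * 2 ^ n"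
        by (simp add: dyadic_term_def dyadic_tail_def power_add field_simps)
      then have "real n + real p + 1 < 4 * 2 ^ p"
        by (rule mult_right_less_imp_less) simp
      then have "real_of_int (int n + int p + 1) < real_of_int (4 * 2 ^ p)"
        by simp
      then have "int n + int p + 1 < 4 * 2 ^ p"
        by (simp only: of_int_less_iff)
      \<comment> \<open>Here \<open>4 * 2 ^ p\<close> is \<open>2 ^ (i + 1)\<close>, because
        \<open>i = p + 1\<close>.\<close>
      then have "int n < 2 ^ (i + 1) - int i"
        by (simp add: p)
      with two_power_Suc_diff_mono[OF less.prems(2)] j(2) show False
        by linarith
    qed
  qed
  show ?thesis
    using bound lower upper dvd initial by auto
qed

end
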